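(* Let $G=(V,E)$ be a connected unit interval graph and let $t\in V$. The following are equivalent: (i) $t$ is simplicial and $G-N[t]$ is connected; (ii) $t$ is the last vertex of some unit interval order of $G$; (iii) $t$ is the last vertex of some MNS ordering of $G$. Moreover, (iii) is also equivalent to each of: $t$ is the last vertex of some MCS ordering of $G$; $t$ is the last vertex of some LDFS ordering of $G$.
   Context: A unit interval graph is the intersection graph of a family of closed intervals of equal length on the real line. A unit interval order of $G$ is an ordering $\sigma$ of $V$ such that whenever $u\prec_\sigma v\prec_\sigma w$ and $uw\in E$, also $uv\in E$ and $vw\in E$. $N[t]=N(t)\cup\{t\}$; a vertex is simplicial if its neighbourhood is a clique. Let $n=|V|$. MNS: the first vertex is arbitrary; at each subsequent step the label of an unnumbered vertex is the set of positions of its already numbered neighbours, and one numbers next an unnumbered vertex whose label is maximal under set inclusion. MCS: the first vertex is arbitrary; at each subsequent step number next an unnumbered vertex with the largest number of already numbered neighbours. LDFS: the start vertex $s$ gets label $(0)$, all others the empty label; for $i=1,\dots,n$, number $i$ an unnumbered vertex $v$ with lexicographically largest label (a string of integers), then prepend $i$ to the label of every unnumbered neighbour of $v$. Ties are broken arbitrarily and an ordering of the search is any possible output. *)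

theory Defs
  imports Complex_Main "Graph_Theory.Graph_Theory"
begin

text \<open>
  Finite simple graphs are represented, as in the library, by finite symmetric digraphs without
  loops and parallel arcs (\<^locale>\<open>Digraph.graph\<close>); \<open>u \<rightarrow>\<^bsub>G\<^esub> v\<close> is adjacency.
\<close>

definition neighbourhood :: "('a, 'b) pre_digraph \<Rightarrow> 'a \<Rightarrow> 'a set" where
  "neighbourhood G v = {u \<in> verts G. v \<rightarrow>\<^bsub>G\<^esub> u}"

definition closed_neighbourhood :: "('a, 'b) pre_digraph \<Rightarrow> 'a \<Rightarrow> 'a set" where
  "closed_neighbourhood G v = insert v (neighbourhood G v)"

definition clique :: "('a, 'b) pre_digraph \<Rightarrow> 'a set \<Rightarrow> bool" where
  "clique G S \<longleftrightarrow> S \<subseteq> verts G \<and> (\<forall>u\<in>S. \<forall>v\<in>S. u \<noteq> v \<longrightarrow> u \<rightarrow>\<^bsub>G\<^esub> v)"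

definition simplicial :: "('a, 'b) pre_digraph \<Rightarrow> 'a \<Rightarrow> bool" where
  "simplicial G v \<longleftrightarrow> v \<in> verts G \<and> clique G (neighbourhood G v)"

definition delete_verts :: "('a, 'b) pre_digraph \<Rightarrow> 'a set \<Rightarrow> ('a, 'b) pre_digraph" where
  "delete_verts G S = G \<restriction> (verts G - S)"

text \<open>
  The library's \<^const>\<open>Digraph_Component.connected\<close> excludes the graph without vertices.  After
  deleting vertices that graph may arise (for instance \<open>G - N[t]\<close> for a complete graph \<open>G\<close>),
  and it has to count as connected there.
\<close>

definition connected_or_null :: "('a, 'b) pre_digraph \<Rightarrow> bool" where
  "connected_or_null G \<longleftrightarrow> verts G = {} \<or> Digraph_Component.connected G"

definition unit_interval_graph :: "('a, 'b) pre_digraph \<Rightarrow> bool" where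
  "unit_interval_graph G \<longleftrightarrow> Digraph.graph G \<and>
     (\<exists>(len :: real) (left :: 'a \<Rightarrow> real). 0 < len \<and>
        (\<forall>u\<in>verts G. \<forall>v\<in>verts G. u \<noteq> v \<longrightarrow>
           (u \<rightarrow>\<^bsub>G\<^esub> v \<longleftrightarrow> {left u .. left u + len} \<inter> {left v .. left v + len} \<noteq> {})))"

definition vertex_ordering :: "('a, 'b) pre_digraph \<Rightarrow> 'a list \<Rightarrow> bool" where
  "vertex_ordering G \<sigma> \<longleftrightarrow> distinct \<sigma> \<and> set \<sigma> = verts G"

definition unit_interval_order :: "('a, 'b) pre_digraph \<Rightarrow> 'a list \<Rightarrow> bool" where
  "unit_interval_order G \<sigma> \<longleftrightarrow> vertex_ordering G \<sigma> \<and>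
     (\<forall>i j k. i < j \<and> j < k \<and> k < length \<sigma> \<and> \<sigma> ! i \<rightarrow>\<^bsub>G\<^esub> \<sigma> ! k \<longrightarrow>
        \<sigma> ! i \<rightarrow>\<^bsub>G\<^esub> \<sigma> ! j \<and> \<sigma> ! j \<rightarrow>\<^bsub>G\<^esub> \<sigma> ! k)"

text \<open>
  In the searches below, \<open>set (take i \<sigma>)\<close> is the set of vertices numbered when \<open>\<sigma> ! i\<close> is chosen.
  For \<open>i = 0\<close> all MNS labels are empty and all MCS counts are \<open>0\<close>, so the first vertex is arbitrary.
\<close>

definition unnumbered :: "('a, 'b) pre_digraph \<Rightarrow> 'a list \<Rightarrow> nat \<Rightarrow> 'a set" where
  "unnumbered G \<sigma> i = verts G - set (take i \<sigma>)"

text \<open>Positions are counted from 1: the vertex at position \<open>p\<close> is \<open>\<sigma> ! (p - 1)\<close>.\<close>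

definition mns_label :: "('a, 'b) pre_digraph \<Rightarrow> 'a list \<Rightarrow> nat \<Rightarrow> 'a \<Rightarrow> nat set" where
  "mns_label G \<sigma> i v = {p \<in> {1..i}. \<sigma> ! (p - 1) \<rightarrow>\<^bsub>G\<^esub> v}"

definition mns_ordering :: "('a, 'b) pre_digraph \<Rightarrow> 'a list \<Rightarrow> bool" where
  "mns_ordering G \<sigma> \<longleftrightarrow> vertex_ordering G \<sigma> \<and>
     (\<forall>i < length \<sigma>. \<forall>v \<in> unnumbered G \<sigma> i.
        \<not> mns_label G \<sigma> i (\<sigma> ! i) \<subset> mns_label G \<sigma> i v)"

definition mcs_ordering :: "('a, 'b) pre_digraph \<Rightarrow> 'a list \<Rightarrow> bool" where
  "mcs_ordering G \<sigma> \<longleftrightarrow> vertex_ordering G \<sigma> \<and>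
     (\<forall>i < length \<sigma>. \<forall>v \<in> unnumbered G \<sigma> i.
        card (neighbourhood G v \<inter> set (take i \<sigma>))
          \<le> card (neighbourhood G (\<sigma> ! i) \<inter> set (take i \<sigma>)))"

text \<open>
  \<open>ldfs_label G s \<sigma> i v\<close> is the label of \<open>v\<close> once the first \<open>i\<close> vertices of \<open>\<sigma>\<close> have been numbered
  \<open>1, \<dots>, i\<close>, in a run with start vertex \<open>s\<close>.
\<close>

primrec ldfs_label :: "('a, 'b) pre_digraph \<Rightarrow> 'a \<Rightarrow> 'a list \<Rightarrow> nat \<Rightarrow> 'a \<Rightarrow> nat list" where
  "ldfs_label G s \<sigma> 0 v = (if v = s then [0] else [])"
| "ldfs_label G s \<sigma> (Suc i) v =
     (if v \<in> unnumbered G \<sigma> (Suc i) \<and> \<sigma> ! i \<rightarrow>\<^bsub>G\<^esub> v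
      then Suc i # ldfs_label G s \<sigma> i v else ldfs_label G s \<sigma> i v)"

text \<open>In \<^const>\<open>lexord\<close> a proper prefix is smaller than the longer list.\<close>

definition ldfs_ordering :: "('a, 'b) pre_digraph \<Rightarrow> 'a list \<Rightarrow> bool" where
  "ldfs_ordering G \<sigma> \<longleftrightarrow> vertex_ordering G \<sigma> \<and>
     (\<exists>s \<in> verts G. \<forall>i < length \<sigma>. \<forall>v \<in> unnumbered G \<sigma> i.
        (ldfs_label G s \<sigma> i v, ldfs_label G s \<sigma> i (\<sigma> ! i)) \<in> (lexord less_than)\<^sup>=)"

end

theory Submission
  imports Defs
begin

text \<open>
  In a unit interval order every earlier neighbour of a later vertex is a neighbour of the next
  vertex, so the order is itself an MCS and an LDFS ordering; and both of these searches are
  special cases of MNS.  Conversely, the last vertex \<open>t\<close> of an MNS ordering is simplicial, by the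
  argument for perfect elimination orderings of chordal graphs, and cannot have non-neighbours on
  both sides of it on the line, because a search started on one side numbers \<open>t\<close> before it
  passes beyond the far end of \<open>N[t]\<close>.  A simplicial vertex with non-neighbours on one
  side only is a twin of an extreme vertex and may be moved to the end of the order.
\<close>

section \<open>Paths inside a vertex set and comparison of descending lists\<close>

definition edges_within :: "('a, 'b) pre_digraph \<Rightarrow> 'a set \<Rightarrow> 'a rel" where
  "edges_within G S = {(u, v) \<in> arcs_ends G. u \<in> S \<and> v \<in> S}"

text \<open>A discrete intermediate value argument: somewhere along the path \<open>P\<close> is
  lost. \<open>P\<close> will be "not to the right of a given point of the line" or "already
  numbered".\<close>

lemma rtrancl_exit_edge:
  assumes "(a, b) \<in> R\<^sup>*" "P a" "\<not> P b"
  obtains u v where "(u, v) \<in> R" "P u" "\<not> P v" "(v, b) \<in> R\<^sup>*"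
proof -
  have "P a \<Longrightarrow> \<exists>u v. (u, v) \<in> R \<and> P u \<and> \<not> P v \<and> (v, b) \<in> R\<^sup>*"
    using assms(1)
  proof (induction rule: converse_rtrancl_induct)
    case base
    then show ?case using assms(3) by simp
  next
    case (step y z)
    then show ?case by (cases "P z") auto
  qed
  then show thesis using assms(2) that by blast
qed

text \<open>The head of a descending list is its maximum, so at the first place where the lists
  differ, \<open>ys\<close> has the larger entry or is the only list left. Lexicographic maximality
  thereby refines maximality under inclusion.\<close>

lemma strictly_descending_subset_lexord:
  fixes xs ys :: "nat list"
  assumes "sorted_wrt (>) xs" "sorted_wrt (>) ys" "set xs \<subseteq> set ys"
  shows "(xs, ys) \<in> (lexord less_than)\<^sup>="
  using assms
proof (induction xs arbitrary: ys)
  case Nil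
  then show ?case by (cases ys) auto
next
  case (Cons x xs)
  then obtain y zs where ys: "ys = y # zs" by (cases ys) auto
  show ?case
  proof (cases "x = y")
    case True
    \<comment> \<open>\<open>x\<close> exceeds all entries of \<open>xs\<close>, so cancelling the
      common head keeps the inclusion.\<close>
    have "set xs \<subseteq> set zs" using Cons.prems True ys by force
    then have "(xs, zs) \<in> (lexord less_than)\<^sup>=" using Cons ys by auto
    then show ?thesis using True ys by auto
  next
    case False
    then have "x < y" using Cons.prems ys by auto
    then show ?thesis using ys by auto
  qed
qed

lemma lexord_less_than_antisym:
  fixes xs ys :: "nat list"
  assumes "(xs, ys) \<in> (lexord less_than)\<^sup>=" "(ys, xs) \<in> (lexord less_than)\<^sup>="
  shows "xs = ys"
proof (rule ccontr)
  assume "xs \<noteq> ys"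
  then have "(xs, ys) \<in> lexord less_than" "(ys, xs) \<in> lexord less_than" using assms by auto
  then have "(xs, xs) \<in> lexord less_than"
    using lexord_transI[OF trans_less_than] by (meson transD)
  then show False using lexord_irreflexive[of less_than] by simp
qed

text \<open>In a symmetric digraph the symmetric closure behind the library's connectedness adds
  nothing, and an \<open>edges_within\<close> path that starts in \<open>S\<close> cannot leave
  \<open>S\<close>. So the ordinary closure suffices; it is monotone in \<open>S\<close>, and paths
  carry over to larger sets.\<close>

lemma connected_iff_edges_within:
  assumes "wf_digraph G" "sym_digraph G" "S \<subseteq> verts G"
  shows "Digraph_Component.connected (G \<restriction> S) \<longleftrightarrow>
    S \<noteq> {} \<and> (\<forall>u\<in>S. \<forall>v\<in>S. (u, v) \<in> (edges_within G S)\<^sup>*)"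
proof -
  have ends: "arcs_ends (G \<restriction> S) = edges_within G S"
    by (auto simp: edges_within_def arcs_ends_def arc_to_ends_def image_iff)
  have "sym (edges_within G S)"
    using assms(2) by (auto simp: sym_def edges_within_def intro: sym_digraph.graph_symmetric)
  then have "(edges_within G S)\<^sup>s = edges_within G S"
    unfolding symcl_def by (auto simp: sym_def)
  moreover have "(u, v) \<in> rtrancl_on S (edges_within G S) \<longleftrightarrow> (u, v) \<in> (edges_within G S)\<^sup>*"
    if "u \<in> S" for u v
  proof
    show "(u, v) \<in> (edges_within G S)\<^sup>*" if "(u, v) \<in> rtrancl_on S (edges_within G S)"
      using that by (rule rtrancl_on_rtranclI)
    show "(u, v) \<in> rtrancl_on S (edges_within G S)" if "(u, v) \<in> (edges_within G S)\<^sup>*"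
      using that \<open>u \<in> S\<close>
    proof induction
      case base
      then show ?case by simp
    next
      case (step v w)
      then show ?case by (auto simp: edges_within_def intro: rtrancl_on_into_rtrancl_on)
    qed
  qed
  ultimately show ?thesis by (auto simp: connected_conv ends)
qed

lemma (in sym_digraph) edges_within_rtrancl_sym:
  "(u, v) \<in> (edges_within G S)\<^sup>* \<Longrightarrow> (v, u) \<in> (edges_within G S)\<^sup>*"
proof -
  have "sym (edges_within G S)"
    by (auto simp: sym_def edges_within_def intro: graph_symmetric)
  then show "(u, v) \<in> (edges_within G S)\<^sup>* \<Longrightarrow> (v, u) \<in> (edges_within G S)\<^sup>*"
    using symD[OF sym_rtrancl] by fast
qed

lemma (in sym_digraph) connected_iff_rtrancl:
  "Digraph_Component.connected G \<longleftrightarrow>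
    verts G \<noteq> {} \<and> (\<forall>u\<in>verts G. \<forall>v\<in>verts G. (u, v) \<in> (arcs_ends G)\<^sup>*)"
proof -
  have "{e \<in> arcs G. tail G e \<in> verts G \<and> head G e \<in> verts G} = arcs G" by auto
  then have "G \<restriction> verts G = G" by (simp add: induce_subgraph_def)
  moreover have "edges_within G (verts G) = arcs_ends G"
    by (auto simp: edges_within_def)
  ultimately show ?thesis
    using connected_iff_edges_within[OF wf_digraph_axioms sym_digraph_axioms subset_refl] by (simp only:)
qed

section \<open>Labels and positions in an ordering\<close>

lemma mns_label_subset_iff:
  "mns_label G \<sigma> j u \<subseteq> mns_label G \<sigma> j v \<longleftrightarrow> (\<forall>l<j. \<sigma> ! l \<rightarrow>\<^bsub>G\<^esub> u \<longrightarrow> \<sigma> ! l \<rightarrow>\<^bsub>G\<^esub> v)"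
proof -
  \<comment> \<open>Positions are counted from 1 and list indices from 0: position
    \<open>Suc l\<close> belongs to \<open>\<sigma> ! l\<close>.\<close>
  have label: "Suc l \<in> mns_label G \<sigma> j w \<longleftrightarrow> l < j \<and> \<sigma> ! l \<rightarrow>\<^bsub>G\<^esub> w" for l w
    by (auto simp: mns_label_def)
  show ?thesis
  proof (intro iffI allI impI subsetI)
    fix l assume "mns_label G \<sigma> j u \<subseteq> mns_label G \<sigma> j v" "l < j" "\<sigma> ! l \<rightarrow>\<^bsub>G\<^esub> u"
    then have "Suc l \<in> mns_label G \<sigma> j v" using label by blast
    then show "\<sigma> ! l \<rightarrow>\<^bsub>G\<^esub> v" using label by blast
  next
    fix p assume adj: "\<forall>l<j. \<sigma> ! l \<rightarrow>\<^bsub>G\<^esub> u \<longrightarrow> \<sigma> ! l \<rightarrow>\<^bsub>G\<^esub> v" and p: "p \<in> mns_label G \<sigma> j u"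
    then obtain l where "p = Suc l" by (cases p) (auto simp: mns_label_def)
    then show "p \<in> mns_label G \<sigma> j v" using adj p label by blast
  qed
qed

lemma vertex_ordering_unnumberedE:
  assumes "vertex_ordering G \<sigma>" "v \<in> unnumbered G \<sigma> i"
  obtains k where "i \<le> k" "k < length \<sigma>" "v = \<sigma> ! k"
proof -
  have "v \<in> set \<sigma>" "v \<notin> set (take i \<sigma>)"
    using assms by (simp_all add: unnumbered_def vertex_ordering_def)
  then obtain k where k: "k < length \<sigma>" "v = \<sigma> ! k" by (auto simp: in_set_conv_nth)
  have "i \<le> k"
  proof (rule ccontr)
    assume "\<not> i \<le> k"
    then have "take i \<sigma> ! k \<in> set (take i \<sigma>)" using k by (intro nth_mem) simp
    then show False using \<open>v \<notin> set (take i \<sigma>)\<close> \<open>\<not> i \<le> k\<close> k by simp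
  qed
  then show thesis using that k by simp
qed

lemma vertex_ordering_nth_unnumbered:
  assumes "vertex_ordering G \<sigma>" "i \<le> k" "k < length \<sigma>"
  shows "\<sigma> ! k \<in> unnumbered G \<sigma> i"
proof -
  have "\<sigma> ! l \<noteq> \<sigma> ! k" if "l < i" for l
    using that assms by (simp add: vertex_ordering_def nth_eq_iff_index_eq)
  moreover have "\<sigma> ! k \<in> verts G" using assms nth_mem[of k \<sigma>] by (simp add: vertex_ordering_def)
  ultimately show ?thesis by (auto simp: unnumbered_def in_set_conv_nth)
qed

text \<open>The four-point property of MNS. When \<open>\<sigma> ! j\<close> is chosen,
  \<open>\<sigma> ! i\<close> contributes to the label of \<open>\<sigma> ! k\<close> but not to
  that of \<open>\<sigma> ! j\<close>. As the latter label is maximal, it must contain a position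
  that the former lacks.\<close>

lemma mns_ordering_prior_neighbour:
  assumes "mns_ordering G \<sigma>" "i < j" "j < k" "k < length \<sigma>"
    and "\<sigma> ! i \<rightarrow>\<^bsub>G\<^esub> \<sigma> ! k" "\<not> \<sigma> ! i \<rightarrow>\<^bsub>G\<^esub> \<sigma> ! j"
  obtains l where "l < j" "\<sigma> ! l \<rightarrow>\<^bsub>G\<^esub> \<sigma> ! j" "\<not> \<sigma> ! l \<rightarrow>\<^bsub>G\<^esub> \<sigma> ! k"
proof -
  have "\<sigma> ! k \<in> unnumbered G \<sigma> j"
    using assms by (intro vertex_ordering_nth_unnumbered) (auto simp: mns_ordering_def)
  then have "\<not> mns_label G \<sigma> j (\<sigma> ! j) \<subset> mns_label G \<sigma> j (\<sigma> ! k)"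
    using assms by (auto simp: mns_ordering_def)
  moreover have "\<not> mns_label G \<sigma> j (\<sigma> ! k) \<subseteq> mns_label G \<sigma> j (\<sigma> ! j)"
    using assms(2,5,6) unfolding mns_label_subset_iff by blast
  ultimately have "\<not> mns_label G \<sigma> j (\<sigma> ! j) \<subseteq> mns_label G \<sigma> j (\<sigma> ! k)" by blast
  then show thesis using that unfolding mns_label_subset_iff by blast
qed

lemma unit_interval_order_umbrella:
  assumes "unit_interval_order G \<sigma>"
    and "i < j" "j < k" "k < length \<sigma>" "\<sigma> ! i \<rightarrow>\<^bsub>G\<^esub> \<sigma> ! k"
  shows "\<sigma> ! i \<rightarrow>\<^bsub>G\<^esub> \<sigma> ! j \<and> \<sigma> ! j \<rightarrow>\<^bsub>G\<^esub> \<sigma> ! k"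
  using assms unfolding unit_interval_order_def by blast

text \<open>The umbrella property for \<open>l < i < k\<close>, where \<open>v\<close> is
  \<open>\<sigma> ! k\<close>. So the label of the next vertex contains every competing label and
  wins by cardinality as well as lexicographically.\<close>

lemma unit_interval_order_label_mono:
  assumes "unit_interval_order G \<sigma>" "l < i" "v \<in> unnumbered G \<sigma> i" "\<sigma> ! l \<rightarrow>\<^bsub>G\<^esub> v"
  shows "\<sigma> ! l \<rightarrow>\<^bsub>G\<^esub> \<sigma> ! i"
proof -
  have "vertex_ordering G \<sigma>" using assms(1) by (simp add: unit_interval_order_def)
  then obtain k where k: "i \<le> k" "k < length \<sigma>" "v = \<sigma> ! k"
    using assms(3) by (rule vertex_ordering_unnumberedE)
  show ?thesis
  proof (cases "i = k")
    case True
    then show ?thesis using assms(4) k by simp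
  next
    case False
    then show ?thesis using unit_interval_order_umbrella[OF assms(1,2), of k] assms(4) k by simp
  qed
qed

section \<open>Comparison of unit interval orders with MCS, LDFS and MNS orderings\<close>

lemma symmetric_adj_commute:
  assumes "symmetric G"
  shows "u \<rightarrow>\<^bsub>G\<^esub> v \<longleftrightarrow> v \<rightarrow>\<^bsub>G\<^esub> u"
  using assms unfolding symmetric_def by (meson symD)

lemma unit_interval_order_is_mcs:
  assumes "unit_interval_order G \<sigma>" "symmetric G"
  shows "mcs_ordering G \<sigma>"
  unfolding mcs_ordering_def
proof (intro conjI allI impI ballI)
  show "vertex_ordering G \<sigma>" using assms by (simp add: unit_interval_order_def)
  fix i v assume i: "i < length \<sigma>" and v: "v \<in> unnumbered G \<sigma> i"
  have "neighbourhood G v \<inter> set (take i \<sigma>) \<subseteq> neighbourhood G (\<sigma> ! i)"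
  proof
    fix u assume u: "u \<in> neighbourhood G v \<inter> set (take i \<sigma>)"
    then obtain l where l: "l < i" "u = \<sigma> ! l" by (auto simp: in_set_conv_nth)
    then have "\<sigma> ! l \<rightarrow>\<^bsub>G\<^esub> v"
      using u symmetric_adj_commute[OF assms(2), of v] by (simp add: neighbourhood_def)
    then have "\<sigma> ! i \<rightarrow>\<^bsub>G\<^esub> u"
      using unit_interval_order_label_mono[OF assms(1) l(1) v] l
        symmetric_adj_commute[OF assms(2), of "\<sigma> ! i"] by simp
    then show "u \<in> neighbourhood G (\<sigma> ! i)" using u by (simp add: neighbourhood_def)
  qed
  then show "card (neighbourhood G v \<inter> set (take i \<sigma>)) \<le> card (neighbourhood G (\<sigma> ! i) \<inter> set (take i \<sigma>))"
    by (intro card_mono) auto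
qed

text \<open>A properly larger label would mean strictly more numbered neighbours, and MCS prefers
  such a vertex. The proof carries the inclusion from sets of positions over to sets of
  vertices.\<close>

lemma mcs_ordering_is_mns:
  assumes "mcs_ordering G \<sigma>" "symmetric G"
  shows "mns_ordering G \<sigma>"
  unfolding mns_ordering_def
proof (intro conjI allI impI ballI notI)
  show vo: "vertex_ordering G \<sigma>" using assms by (simp add: mcs_ordering_def)
  fix i v assume i: "i < length \<sigma>" and v: "v \<in> unnumbered G \<sigma> i"
    and less: "mns_label G \<sigma> i (\<sigma> ! i) \<subset> mns_label G \<sigma> i v"
  let ?N = "\<lambda>u. neighbourhood G u \<inter> set (take i \<sigma>)"
  have adj_iff: "\<sigma> ! l \<rightarrow>\<^bsub>G\<^esub> u \<longleftrightarrow> \<sigma> ! l \<in> ?N u" if "l < i" for l u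
    using that i vo nth_mem[of l \<sigma>] symmetric_adj_commute[OF assms(2), of u]
    by (auto simp: neighbourhood_def vertex_ordering_def in_set_conv_nth)
  have "?N (\<sigma> ! i) \<subseteq> ?N v"
  proof
    fix u assume u: "u \<in> ?N (\<sigma> ! i)"
    then obtain l where l: "l < i" "u = \<sigma> ! l" by (auto simp: in_set_conv_nth)
    have "\<sigma> ! l \<rightarrow>\<^bsub>G\<^esub> \<sigma> ! i" unfolding adj_iff[OF l(1)] using u unfolding l(2) .
    then have "\<sigma> ! l \<rightarrow>\<^bsub>G\<^esub> v"
      using psubset_imp_subset[OF less] l(1) unfolding mns_label_subset_iff by blast
    then show "u \<in> ?N v" unfolding adj_iff[OF l(1)] l(2) .
  qed
  moreover have "\<not> ?N v \<subseteq> ?N (\<sigma> ! i)"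
  proof -
    have "\<not> mns_label G \<sigma> i v \<subseteq> mns_label G \<sigma> i (\<sigma> ! i)" using less by blast
    then obtain l where l: "l < i" "\<sigma> ! l \<rightarrow>\<^bsub>G\<^esub> v" "\<not> \<sigma> ! l \<rightarrow>\<^bsub>G\<^esub> \<sigma> ! i"
      unfolding mns_label_subset_iff by blast
    show ?thesis using l(2,3) unfolding adj_iff[OF l(1)] by (meson subsetD)
  qed
  ultimately have "?N (\<sigma> ! i) \<subset> ?N v" unfolding less_le_not_le by (rule conjI)
  then have "card (neighbourhood G (\<sigma> ! i) \<inter> set (take i \<sigma>)) < card (neighbourhood G v \<inter> set (take i \<sigma>))"
    by (rule psubset_card_mono[rotated]) simp
  moreover have "card (neighbourhood G v \<inter> set (take i \<sigma>)) \<le> card (neighbourhood G (\<sigma> ! i) \<inter> set (take i \<sigma>))"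
    using assms(1) i v unfolding mcs_ordering_def by blast
  ultimately show False by (meson leD)
qed

text \<open>Numbers are prepended in increasing order, so while \<open>v\<close> is unnumbered its
  string lists the MNS label downwards. The start vertex has in addition its initial 0, which is not
  a position.\<close>

lemma ldfs_label_unnumbered:
  assumes "v \<in> unnumbered G \<sigma> i"
  shows "sorted_wrt (>) (ldfs_label G s \<sigma> i v)
    \<and> set (ldfs_label G s \<sigma> i v) = mns_label G \<sigma> i v \<union> (if v = s then {0} else {})"
  using assms
proof (induction i)
  case 0
  then show ?case by (auto simp: mns_label_def)
next
  case (Suc i)
  have "set (take i \<sigma>) \<subseteq> set (take (Suc i) \<sigma>)" by (simp add: set_take_subset_set_take)
  then have v: "v \<in> unnumbered G \<sigma> i" using Suc.prems by (auto simp: unnumbered_def)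
  have label: "mns_label G \<sigma> (Suc i) v =
      (if \<sigma> ! i \<rightarrow>\<^bsub>G\<^esub> v then insert (Suc i) (mns_label G \<sigma> i v) else mns_label G \<sigma> i v)"
    by (auto simp: mns_label_def le_Suc_eq)
  have "mns_label G \<sigma> i v \<subseteq> {..i}" by (auto simp: mns_label_def)
  \<comment> \<open>All entries so far are below \<open>Suc i\<close>, so prepending
    \<open>Suc i\<close> keeps the string strictly descending.\<close>
  then have "\<forall>p \<in> mns_label G \<sigma> i v \<union> (if v = s then {0} else {}). p < Suc i"
    by auto
  with Suc.IH[OF v] Suc.prems show ?case by (auto simp: label)
qed

text \<open>Initially only \<open>s\<close> has a nonempty label, and \<open>[0]\<close> exceeds the
  empty list, so the first choice is forced.\<close>

lemma ldfs_label_start: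
  assumes "vertex_ordering G \<sigma>" "s \<in> verts G"
    and "\<forall>v \<in> unnumbered G \<sigma> 0. (ldfs_label G s \<sigma> 0 v, ldfs_label G s \<sigma> 0 (\<sigma> ! 0)) \<in> (lexord less_than)\<^sup>="
  shows "\<sigma> ! 0 = s"
  using assms by (auto simp: unnumbered_def split: if_splits dest!: bspec[where x = s])

lemma vertex_ordering_unnumbered_not_first:
  assumes "vertex_ordering G \<sigma>" "0 < i" "v \<in> unnumbered G \<sigma> i"
  shows "v \<noteq> \<sigma> ! 0"
proof -
  obtain k where "i \<le> k" "k < length \<sigma>" "v = \<sigma> ! k"
    using vertex_ordering_unnumberedE[OF assms(1,3)] .
  moreover from this have "0 < length \<sigma>" by auto
  ultimately show ?thesis
    using assms nth_eq_iff_index_eq[of \<sigma> k 0] unfolding vertex_ordering_def by simp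
qed

text \<open>The run starts at \<open>\<sigma> ! 0\<close>. The label of \<open>\<sigma> ! i\<close>
  contains those of all competitors, and for descending strings inclusion gives lexicographic
  order.\<close>

lemma unit_interval_order_is_ldfs:
  assumes "unit_interval_order G \<sigma>" "verts G \<noteq> {}"
  shows "ldfs_ordering G \<sigma>"
proof -
  have vo: "vertex_ordering G \<sigma>" using assms by (simp add: unit_interval_order_def)
  have max: "(ldfs_label G (\<sigma> ! 0) \<sigma> i v, ldfs_label G (\<sigma> ! 0) \<sigma> i (\<sigma> ! i)) \<in> (lexord less_than)\<^sup>="
    if i: "i < length \<sigma>" and v: "v \<in> unnumbered G \<sigma> i" for i v
  proof -
    have \<sigma>i: "\<sigma> ! i \<in> unnumbered G \<sigma> i" using vertex_ordering_nth_unnumbered[OF vo _ i] by simp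
    have "mns_label G \<sigma> i v \<subseteq> mns_label G \<sigma> i (\<sigma> ! i)"
      using unit_interval_order_label_mono[OF assms(1) _ v] by (auto simp: mns_label_subset_iff)
    \<comment> \<open>The extra 0 of the start vertex keeps the inclusion: an unnumbered
      \<open>v\<close> is the start vertex only for \<open>i = 0\<close>, and then so is
      \<open>\<sigma> ! i\<close>.\<close>
    moreover have "v = \<sigma> ! 0 \<Longrightarrow> \<sigma> ! i = \<sigma> ! 0"
      using vertex_ordering_unnumbered_not_first[OF vo _ v] by (cases "i = 0") auto
    ultimately show ?thesis
      using ldfs_label_unnumbered[OF v] ldfs_label_unnumbered[OF \<sigma>i]
      by (intro strictly_descending_subset_lexord) auto
  qed
  have start: "\<sigma> ! 0 \<in> verts G" using vo assms(2) by (cases \<sigma>) (auto simp: vertex_ordering_def)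
  show ?thesis
    unfolding ldfs_ordering_def by (intro conjI vo bexI[OF _ start] allI impI ballI max)
qed

text \<open>Proper inclusion of MNS labels would put the string of \<open>v\<close> at least as high
  as that of the chosen vertex. The search rule gives the converse, so the strings, and with them
  the labels, would coincide.\<close>

lemma ldfs_ordering_is_mns:
  assumes "ldfs_ordering G \<sigma>"
  shows "mns_ordering G \<sigma>"
  unfolding mns_ordering_def
proof (intro conjI allI impI ballI notI)
  show vo: "vertex_ordering G \<sigma>" using assms by (simp add: ldfs_ordering_def)
  fix i v assume i: "i < length \<sigma>" and v: "v \<in> unnumbered G \<sigma> i"
    and less: "mns_label G \<sigma> i (\<sigma> ! i) \<subset> mns_label G \<sigma> i v"
  obtain s where s: "s \<in> verts G" and max: "\<forall>i<length \<sigma>. \<forall>v\<in>unnumbered G \<sigma> i.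
      (ldfs_label G s \<sigma> i v, ldfs_label G s \<sigma> i (\<sigma> ! i)) \<in> (lexord less_than)\<^sup>="
    using assms unfolding ldfs_ordering_def by (elim conjE bexE)
  have "0 < length \<sigma>" using i by (rule le_less_trans[OF le0])
  then have "\<sigma> ! 0 = s"
    using ldfs_label_start[OF vo s max[THEN spec, THEN mp]] by blast
  \<comment> \<open>For \<open>i = 0\<close> all MNS labels are empty. For \<open>i > 0\<close>
    neither vertex is the start vertex, so the entry 0 does not occur in the two strings.\<close>
  have "0 < i" using less by (cases i) (auto simp: mns_label_def)
  have \<sigma>i: "\<sigma> ! i \<in> unnumbered G \<sigma> i" using vertex_ordering_nth_unnumbered[OF vo _ i] by simp
  have "v \<noteq> s" "\<sigma> ! i \<noteq> s"
    using vertex_ordering_unnumbered_not_first[OF vo \<open>0 < i\<close>] v \<sigma>i \<open>\<sigma> ! 0 = s\<close> by auto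
  then have labels: "set (ldfs_label G s \<sigma> i (\<sigma> ! i)) = mns_label G \<sigma> i (\<sigma> ! i)"
      "set (ldfs_label G s \<sigma> i v) = mns_label G \<sigma> i v"
    using ldfs_label_unnumbered[OF v, of s] ldfs_label_unnumbered[OF \<sigma>i, of s] by simp_all
  have "(ldfs_label G s \<sigma> i (\<sigma> ! i), ldfs_label G s \<sigma> i v) \<in> (lexord less_than)\<^sup>="
  proof (rule strictly_descending_subset_lexord)
    show "sorted_wrt (>) (ldfs_label G s \<sigma> i (\<sigma> ! i))" "sorted_wrt (>) (ldfs_label G s \<sigma> i v)"
      using ldfs_label_unnumbered[OF v, of s] ldfs_label_unnumbered[OF \<sigma>i, of s] by blast+
    show "set (ldfs_label G s \<sigma> i (\<sigma> ! i)) \<subseteq> set (ldfs_label G s \<sigma> i v)"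
      unfolding labels by (rule psubset_imp_subset[OF less])
  qed
  then have "ldfs_label G s \<sigma> i (\<sigma> ! i) = ldfs_label G s \<sigma> i v"
    using max[rule_format, OF i v] by (rule lexord_less_than_antisym)
  then show False using labels less by simp
qed

section \<open>Representations by left end points on the line\<close>

text \<open>Two intervals of length \<open>len\<close> meet iff their left end points \<open>f u\<close>, \<open>f v\<close> are at distance at
  most \<open>len\<close>.  Negating \<open>f\<close> gives another such representation, which serves as the reflection of
  the line.\<close>

locale unit_interval_representation = graph G for G :: "('a, 'b) pre_digraph" +
  fixes f :: "'a \<Rightarrow> real" and len :: real
  assumes len_nonneg: "0 \<le> len"
    and adj_iff: "\<lbrakk>u \<in> verts G; v \<in> verts G\<rbrakk> \<Longrightarrow> u \<rightarrow>\<^bsub>G\<^esub> v \<longleftrightarrow> u \<noteq> v \<and> \<bar>f u - f v\<bar> \<le> len"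

lemma (in unit_interval_representation) reflect:
  "unit_interval_representation G (\<lambda>v. - f v) len"
  by unfold_locales (use len_nonneg in \<open>auto simp: adj_iff abs_minus_commute\<close>)

lemma unit_interval_graphE:
  assumes "unit_interval_graph G"
  obtains f len where "unit_interval_representation G f len"
proof -
  obtain len :: real and f where G: "Digraph.graph G" and len: "0 < len"
    and adj: "\<And>u v. \<lbrakk>u \<in> verts G; v \<in> verts G; u \<noteq> v\<rbrakk> \<Longrightarrow>
      u \<rightarrow>\<^bsub>G\<^esub> v \<longleftrightarrow> {f u .. f u + len} \<inter> {f v .. f v + len} \<noteq> {}"
    using assms unfolding unit_interval_graph_def by blast
  interpret Digraph.graph G by fact
  have meet: "{f u .. f u + len} \<inter> {f v .. f v + len} \<noteq> {} \<longleftrightarrow> \<bar>f u - f v\<bar> \<le> len" for u v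
    using len by (auto simp: Int_atLeastAtMost)
  have "unit_interval_representation G f len"
  proof
    show "0 \<le> len" using len by simp
    fix u v assume uv: "u \<in> verts G" "v \<in> verts G"
    show "u \<rightarrow>\<^bsub>G\<^esub> v \<longleftrightarrow> u \<noteq> v \<and> \<bar>f u - f v\<bar> \<le> len"
    proof (cases "u = v")
      case True
      then show ?thesis using adj_not_same by blast
    next
      case False
      then show ?thesis using adj[OF uv] unfolding meet by simp
    qed
  qed
  then show thesis by (rule that)
qed

section \<open>Simplicial vertices at the end of a unit interval order\<close>

context unit_interval_representation
begin

lemma adj_sym: "u \<rightarrow>\<^bsub>G\<^esub> v \<Longrightarrow> v \<rightarrow>\<^bsub>G\<^esub> u"
  by (rule graph_symmetric)

text \<open>Sorting by decreasing \<open>f\<close> only has to be corrected at \<open>t\<close>; whatever precedes \<open>t\<close> on the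
  line is adjacent to \<open>t\<close>, so that \<open>t\<close> may be moved to the end.\<close>

lemma unit_interval_order_ending_at:
  assumes t: "simplicial G t" and left: "\<And>u. u \<in> verts G \<Longrightarrow> f u < f t \<Longrightarrow> u \<rightarrow>\<^bsub>G\<^esub> t"
  shows "\<exists>\<sigma>. unit_interval_order G \<sigma> \<and> last \<sigma> = t"
proof -
  have tV: "t \<in> verts G" using t by (simp add: simplicial_def)
  obtain xs where xs: "set xs = verts G - {t}" "distinct xs"
    using finite_distinct_list[of "verts G - {t}"] by auto
  define ys where "ys = sort_key (\<lambda>v. - f v) xs"
  have ys: "set ys = verts G - {t}" "distinct ys" using xs by (auto simp: ys_def)
  have sorted: "f (ys ! j) \<le> f (ys ! i)" if "i \<le> j" "j < length ys" for i j
  proof -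
    have "sorted (map (\<lambda>v. - f v) ys)" by (simp add: ys_def)
    then show ?thesis using that sorted_nth_mono[of "map (\<lambda>v. - f v) ys" i j] by simp
  qed
  have inV: "ys ! i \<in> verts G" "ys ! i \<noteq> t" if "i < length ys" for i
    using that ys nth_mem[of i ys] by auto
  have "unit_interval_order G (ys @ [t])"
    unfolding unit_interval_order_def
  proof (intro conjI allI impI; (elim conjE)?)
    show "vertex_ordering G (ys @ [t])" using ys tV by (auto simp: vertex_ordering_def)
    fix i j k assume ijk: "i < j" "j < k" "k < length (ys @ [t])" "(ys @ [t]) ! i \<rightarrow>\<^bsub>G\<^esub> (ys @ [t]) ! k"
    define u v w where uvw: "u = ys ! i" "v = ys ! j" "w = (ys @ [t]) ! k"
    have lt: "i < length ys" "j < length ys" using ijk by auto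
    have nth: "(ys @ [t]) ! i = u" "(ys @ [t]) ! j = v" using lt by (auto simp: nth_append uvw)
    have V: "u \<in> verts G" "v \<in> verts G" "u \<noteq> t" "v \<noteq> t" using inV lt uvw by auto
    have "u \<noteq> v" using ys(2) lt ijk(1) uvw by (auto simp: nth_eq_iff_index_eq)
    have fuv: "f v \<le> f u" using sorted lt ijk uvw by simp
    have uw: "u \<rightarrow>\<^bsub>G\<^esub> w" using ijk nth uvw by simp
    have "u \<rightarrow>\<^bsub>G\<^esub> v \<and> v \<rightarrow>\<^bsub>G\<^esub> w"
    proof (cases "k < length ys")
      case True
      then have w: "w = ys ! k" by (simp add: nth_append uvw)
      then have "v \<noteq> w" "w \<in> verts G" using ys(2) lt True ijk inV uvw
        by (auto simp: nth_eq_iff_index_eq)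
      moreover have "f w \<le> f v" using sorted[of j k] True ijk(2) unfolding w uvw(2) by simp
      ultimately show ?thesis using uw V \<open>u \<noteq> v\<close> fuv by (auto simp: adj_iff)
    next
      case False
      then have w: "w = t" using ijk uvw by (auto simp: nth_append)
      \<comment> \<open>To the left of \<open>t\<close> this is the assumption \<open>left\<close>;
        otherwise \<open>f t \<le> f v \<le> f u\<close>, so \<open>v\<close> is at least as close
        to \<open>t\<close> as its neighbour \<open>u\<close>.\<close>
      have vt: "v \<rightarrow>\<^bsub>G\<^esub> t"
      proof (cases "f v < f t")
        case True
        then show ?thesis using left V by blast
      next
        case False
        then show ?thesis using V tV uw fuv unfolding w by (simp add: adj_iff)
      qed
      \<comment> \<open>\<open>t\<close> need not be leftmost on the line, so this edge comes from
        simpliciality: \<open>u\<close> and \<open>v\<close> are both neighbours of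
        \<open>t\<close>.\<close>
      have "u \<rightarrow>\<^bsub>G\<^esub> v"
      proof -
        have "u \<in> neighbourhood G t" "v \<in> neighbourhood G t"
          using V adj_sym[OF uw] adj_sym[OF vt] w by (simp_all add: neighbourhood_def)
        then show ?thesis using t \<open>u \<noteq> v\<close> by (simp add: simplicial_def clique_def)
      qed
      then show ?thesis using vt w by simp
    qed
    then show "(ys @ [t]) ! i \<rightarrow>\<^bsub>G\<^esub> (ys @ [t]) ! j" "(ys @ [t]) ! j \<rightarrow>\<^bsub>G\<^esub> (ys @ [t]) ! k"
      using nth uvw by auto
  qed
  then show ?thesis by force
qed

text \<open>If no vertex lies beyond the left end of the range of \<open>t\<close>, then
  \<open>t\<close> can be moved to the end directly. Otherwise \<open>one_sided\<close> clears the
  right side, and reflecting the line reduces to the first case.\<close>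

lemma unit_interval_order_ending_at_if_one_sided:
  assumes t: "simplicial G t"
    and one_sided: "\<And>c d. \<lbrakk>c \<in> verts G; d \<in> verts G; f c < f t - len\<rbrakk> \<Longrightarrow> f d \<le> f t + len"
  shows "\<exists>\<sigma>. unit_interval_order G \<sigma> \<and> last \<sigma> = t"
proof (cases "\<exists>c\<in>verts G. f c < f t - len")
  case False
  show ?thesis
  proof (rule unit_interval_order_ending_at[OF t])
    fix u assume u: "u \<in> verts G" "f u < f t"
    then have "\<not> f u < f t - len" using False by blast
    then show "u \<rightarrow>\<^bsub>G\<^esub> t" using u adj_iff[of u t] t by (auto simp: simplicial_def)
  qed
next
  case True
  interpret R: unit_interval_representation G "\<lambda>v. - f v" len by (rule reflect)
  show ?thesis
  proof (rule R.unit_interval_order_ending_at[OF t])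
    fix u assume u: "u \<in> verts G" "- f u < - f t"
    then have "f u \<le> f t + len" using True one_sided by blast
    then show "u \<rightarrow>\<^bsub>G\<^esub> t" using u adj_iff[of u t] t by (auto simp: simplicial_def)
  qed
qed

text \<open>Non-neighbours on both sides of \<open>t\<close> would be joined by a path avoiding
  N[t]. Some edge of it crosses \<open>f t\<close>, with its ends on either side farther than
  \<open>len\<close> from \<open>t\<close> and hence too far apart to be adjacent.\<close>

lemma simplicial_connected_imp_unit_interval_order:
  assumes t: "simplicial G t" and conn: "connected_or_null (delete_verts G (closed_neighbourhood G t))"
  shows "\<exists>\<sigma>. unit_interval_order G \<sigma> \<and> last \<sigma> = t"
proof (rule unit_interval_order_ending_at_if_one_sided[OF t], rule ccontr)
  fix c d assume cd: "c \<in> verts G" "d \<in> verts G" "f c < f t - len" "\<not> f d \<le> f t + len"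
  define S where "S = verts G - closed_neighbourhood G t"
  have tV: "t \<in> verts G" using t by (simp add: simplicial_def)
  \<comment> \<open>As \<open>0 \<le> len\<close>, the distance condition excludes \<open>t\<close>
    itself along with its neighbours.\<close>
  have S_iff: "u \<in> S \<longleftrightarrow> u \<in> verts G \<and> \<not> \<bar>f t - f u\<bar> \<le> len" for u
  proof (cases "u \<in> verts G")
    case True
    then show ?thesis
      using adj_iff[OF tV True] len_nonneg
      by (auto simp: S_def closed_neighbourhood_def neighbourhood_def)
  qed (simp add: S_def)
  have cdS: "c \<in> S" "d \<in> S" using cd by (simp_all add: S_iff)
  have "connected_or_null (G \<restriction> S)" using conn by (simp add: delete_verts_def S_def)
  then have "Digraph_Component.connected (G \<restriction> S)"
    using cdS unfolding connected_or_null_def induce_subgraph_verts by blast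
  moreover have "S \<subseteq> verts G" by (simp add: S_def)
  ultimately have "(c, d) \<in> (edges_within G S)\<^sup>*"
    using connected_iff_edges_within[OF wf_digraph_axioms sym_digraph_axioms] cdS by blast
  moreover have "f c \<le> f t" "\<not> f d \<le> f t" using cd len_nonneg by simp_all
  ultimately obtain u v where uv: "(u, v) \<in> edges_within G S" "f u \<le> f t" "\<not> f v \<le> f t"
    by (rule rtrancl_exit_edge[where P = "\<lambda>w. f w \<le> f t"])
  then have "u \<rightarrow>\<^bsub>G\<^esub> v" "u \<in> S" "v \<in> S" by (simp_all add: edges_within_def)
  then show False using uv(2,3) adj_iff[of u v] by (auto simp: S_iff)
qed

end

section \<open>The last vertex of a unit interval order\<close>

text \<open>By connectedness some edge joins an index \<open>a \<le> i\<close> to an index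
  \<open>b \<ge> Suc i\<close>. The umbrella property first pulls \<open>b\<close> back to
  \<open>Suc i\<close>, then \<open>a\<close> forward to \<open>i\<close>.\<close>

lemma unit_interval_order_consecutive_adjacent:
  assumes "sym_digraph G" "Digraph_Component.connected G" "unit_interval_order G \<sigma>" "Suc i < length \<sigma>"
  shows "\<sigma> ! i \<rightarrow>\<^bsub>G\<^esub> \<sigma> ! Suc i"
proof -
  interpret sym_digraph G by fact
  have vo: "set \<sigma> = verts G" "distinct \<sigma>"
    using assms(3) by (auto simp: unit_interval_order_def vertex_ordering_def)
  note umbrella = unit_interval_order_umbrella[OF assms(3)]
  have "\<sigma> \<noteq> []" using assms(4) by auto
  then have "(\<sigma> ! 0, \<sigma> ! Suc i) \<in> (arcs_ends G)\<^sup>*"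
    using assms(2,4) vo(1) nth_mem[of 0 \<sigma>] nth_mem[of "Suc i" \<sigma>]
    by (auto simp: connected_iff_rtrancl)
  moreover have "\<sigma> ! 0 \<in> set (take (Suc i) \<sigma>)" using assms(4) by (auto simp: in_set_conv_nth)
  moreover have "\<sigma> ! Suc i \<notin> set (take (Suc i) \<sigma>)"
    using assms(4) vo by (auto simp: in_set_conv_nth nth_eq_iff_index_eq)
  ultimately obtain u v where uv: "u \<rightarrow>\<^bsub>G\<^esub> v" "u \<in> set (take (Suc i) \<sigma>)" "v \<notin> set (take (Suc i) \<sigma>)"
    by (rule rtrancl_exit_edge[where P = "\<lambda>w. w \<in> set (take (Suc i) \<sigma>)"])
  obtain a where a: "a \<le> i" "u = \<sigma> ! a"
    using uv(2) unfolding in_set_conv_nth by (auto simp: less_Suc_eq_le)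
  have "v \<in> verts G" using uv(1) by (rule adj_in_verts)
  then have "v \<in> unnumbered G \<sigma> (Suc i)" using uv(3) by (simp add: unnumbered_def)
  moreover have "vertex_ordering G \<sigma>" using assms(3) by (simp add: unit_interval_order_def)
  ultimately obtain b where b: "Suc i \<le> b" "b < length \<sigma>" "v = \<sigma> ! b"
    by (elim vertex_ordering_unnumberedE)
  have "\<sigma> ! a \<rightarrow>\<^bsub>G\<^esub> \<sigma> ! Suc i"
  proof (cases "Suc i = b")
    case True
    then show ?thesis using uv(1) a b by simp
  next
    case False
    then show ?thesis using umbrella[of a "Suc i" b] uv(1) a b by simp
  qed
  then show ?thesis
  proof (cases "a = i")
    case False
    then show ?thesis
      using umbrella[of a i "Suc i"] a(1) assms(4) \<open>\<sigma> ! a \<rightarrow>\<^bsub>G\<^esub> \<sigma> ! Suc i\<close> by simp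
  qed simp
qed

text \<open>For neighbours at indices \<open>i < j\<close> of the vertex at the last index
  \<open>n\<close>, the umbrella over \<open>i < j < n\<close> supplies the edge between
  them.\<close>

lemma unit_interval_order_last_simplicial:
  assumes "Digraph.graph G" "unit_interval_order G \<sigma>" "verts G \<noteq> {}"
  shows "simplicial G (last \<sigma>)"
proof -
  interpret Digraph.graph G by fact
  have vo: "set \<sigma> = verts G" "\<sigma> \<noteq> []"
    using assms(2,3) by (auto simp: unit_interval_order_def vertex_ordering_def)
  note umbrella = unit_interval_order_umbrella[OF assms(2)]
  define n where "n = length \<sigma> - 1"
  have n: "last \<sigma> = \<sigma> ! n" "n < length \<sigma>" using vo by (auto simp: last_conv_nth n_def)
  have "u \<rightarrow>\<^bsub>G\<^esub> v" if uv: "\<sigma> ! n \<rightarrow>\<^bsub>G\<^esub> u" "\<sigma> ! n \<rightarrow>\<^bsub>G\<^esub> v" "u \<noteq> v" for u v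
  proof -
    have index: "\<exists>i<n. w = \<sigma> ! i" if w: "\<sigma> ! n \<rightarrow>\<^bsub>G\<^esub> w" for w
    proof -
      have "w \<in> set \<sigma>" using adj_in_verts(2)[OF w] vo(1) by simp
      then obtain i where i: "i < length \<sigma>" "w = \<sigma> ! i" by (auto simp: in_set_conv_nth)
      then have "i \<noteq> n" using w adj_not_same by blast
      then have "i < n" using i(1) by (simp add: n_def)
      then show ?thesis using i(2) by blast
    qed
    obtain i where i: "i < n" "u = \<sigma> ! i" using index[OF uv(1)] by blast
    obtain j where j: "j < n" "v = \<sigma> ! j" using index[OF uv(2)] by blast
    have "i \<noteq> j" using i j uv(3) by blast
    then consider "i < j" | "j < i" by linarith
    then show ?thesis
    proof cases
      case 1
      then show ?thesis using umbrella[of i j n] i j n(2) graph_symmetric[OF uv(1)] by simp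
    next
      case 2
      then have "v \<rightarrow>\<^bsub>G\<^esub> u" using umbrella[of j i n] i j n(2) graph_symmetric[OF uv(2)] by simp
      then show ?thesis by (rule graph_symmetric)
    qed
  qed
  moreover have "\<sigma> ! n \<in> verts G" using nth_mem[OF n(2)] vo(1) by simp
  ultimately show ?thesis
    unfolding simplicial_def clique_def neighbourhood_def n(1) by blast
qed

text \<open>By the umbrella property a vertex just before a non-neighbour of the last vertex is
  again a non-neighbour. So the non-neighbours form an initial segment, in which consecutive
  vertices are adjacent.\<close>

lemma unit_interval_order_last_non_neighbours_connected:
  assumes "Digraph.graph G" "Digraph_Component.connected G" "unit_interval_order G \<sigma>"
  shows "connected_or_null (delete_verts G (closed_neighbourhood G (last \<sigma>)))"
proof -
  interpret Digraph.graph G by fact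
  define S where "S = verts G - closed_neighbourhood G (last \<sigma>)"
  have vo: "set \<sigma> = verts G" "distinct \<sigma>" "\<sigma> \<noteq> []"
    using assms(2,3) by (auto simp: unit_interval_order_def vertex_ordering_def connected_iff_rtrancl)
  note umbrella = unit_interval_order_umbrella[OF assms(3)]
  define n where "n = length \<sigma> - 1"
  have n: "last \<sigma> = \<sigma> ! n" "n < length \<sigma>" using vo by (auto simp: last_conv_nth n_def)
  have S_iff: "\<sigma> ! i \<in> S \<longleftrightarrow> i < n \<and> \<not> \<sigma> ! i \<rightarrow>\<^bsub>G\<^esub> \<sigma> ! n" if "i < length \<sigma>" for i
  proof -
    have "\<sigma> ! i = \<sigma> ! n \<longleftrightarrow> i = n" using that n vo by (simp add: nth_eq_iff_index_eq)
    then show ?thesis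
      using that n vo(1) graph_symmetric[of "\<sigma> ! i" "\<sigma> ! n"] graph_symmetric[of "\<sigma> ! n" "\<sigma> ! i"]
        nth_mem[of i \<sigma>]
      by (auto simp: S_def closed_neighbourhood_def neighbourhood_def n_def)
  qed
  have reach: "(\<sigma> ! 0, \<sigma> ! i) \<in> (edges_within G S)\<^sup>*" if "i < length \<sigma>" "\<sigma> ! i \<in> S" for i
    using that
  proof (induction i)
    case 0
    then show ?case by simp
  next
    case (Suc i)
    have "\<sigma> ! i \<in> S" using Suc.prems umbrella[of i "Suc i" n] n by (auto simp: S_iff)
    moreover have "\<sigma> ! i \<rightarrow>\<^bsub>G\<^esub> \<sigma> ! Suc i"
      using unit_interval_order_consecutive_adjacent assms(2,3) Suc.prems sym_digraph_axioms by blast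
    ultimately show ?case using Suc by (auto simp: edges_within_def intro: rtrancl_into_rtrancl)
  qed
  have "(u, v) \<in> (edges_within G S)\<^sup>*" if "u \<in> S" "v \<in> S" for u v
  proof -
    have "u \<in> set \<sigma>" "v \<in> set \<sigma>" using that vo by (auto simp: S_def)
    then have "(\<sigma> ! 0, u) \<in> (edges_within G S)\<^sup>*" "(\<sigma> ! 0, v) \<in> (edges_within G S)\<^sup>*"
      using reach that by (auto simp: in_set_conv_nth)
    then show ?thesis using edges_within_rtrancl_sym by (meson rtrancl_trans)
  qed
  moreover have "S \<subseteq> verts G" by (auto simp: S_def)
  ultimately have "S = {} \<or> Digraph_Component.connected (G \<restriction> S)"
    using connected_iff_edges_within[of G S] wf_digraph_axioms sym_digraph_axioms by blast
  then show ?thesis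
    unfolding connected_or_null_def delete_verts_def S_def[symmetric] induce_subgraph_verts .
qed

section \<open>The last vertex of an MNS ordering\<close>

text \<open>Some edge leads from a numbered \<open>\<sigma> ! a\<close> to an unnumbered
  \<open>\<sigma> ! b\<close>. If \<open>\<sigma> ! a\<close> misses \<open>\<sigma> ! j\<close>,
  the four-point property supplies another earlier neighbour.\<close>

lemma mns_ordering_earlier_neighbour:
  assumes "sym_digraph G" "Digraph_Component.connected G" "mns_ordering G \<sigma>" "0 < j" "j < length \<sigma>"
  obtains k where "k < j" "\<sigma> ! k \<rightarrow>\<^bsub>G\<^esub> \<sigma> ! j"
proof -
  interpret sym_digraph G by fact
  have vo: "vertex_ordering G \<sigma>" using assms(3) by (simp add: mns_ordering_def)
  have "\<sigma> \<noteq> []" using assms(5) by auto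
  then have "(\<sigma> ! 0, \<sigma> ! j) \<in> (arcs_ends G)\<^sup>*"
    using assms(2,4,5) vo nth_mem[of 0 \<sigma>] nth_mem[of j \<sigma>]
    by (auto simp: connected_iff_rtrancl vertex_ordering_def)
  moreover have "\<sigma> ! 0 \<in> set (take j \<sigma>)" using assms(4,5) by (auto simp: in_set_conv_nth)
  moreover have "\<sigma> ! j \<notin> set (take j \<sigma>)"
    using assms(5) vo by (auto simp: in_set_conv_nth nth_eq_iff_index_eq vertex_ordering_def)
  ultimately obtain u v where uv: "u \<rightarrow>\<^bsub>G\<^esub> v" "u \<in> set (take j \<sigma>)" "v \<notin> set (take j \<sigma>)"
    by (rule rtrancl_exit_edge[where P = "\<lambda>w. w \<in> set (take j \<sigma>)"])
  obtain a where a: "a < j" "u = \<sigma> ! a"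
    using uv(2) unfolding in_set_conv_nth by auto
  have "v \<in> verts G" using uv(1) by (rule adj_in_verts)
  then have "v \<in> unnumbered G \<sigma> j" using uv(3) by (simp add: unnumbered_def)
  then obtain b where b: "j \<le> b" "b < length \<sigma>" "v = \<sigma> ! b"
    by (rule vertex_ordering_unnumberedE[OF vo])
  show thesis
  proof (cases "\<sigma> ! a \<rightarrow>\<^bsub>G\<^esub> \<sigma> ! j")
    case True
    then show thesis using that a by blast
  next
    case False
    then have "j \<noteq> b" using uv(1) a(2) b(3) by blast
    then have "j < b" using b(1) by simp
    moreover have "\<sigma> ! a \<rightarrow>\<^bsub>G\<^esub> \<sigma> ! b" using uv(1) a(2) b(3) by simp
    ultimately obtain l where "l < j" "\<sigma> ! l \<rightarrow>\<^bsub>G\<^esub> \<sigma> ! j"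
      using mns_ordering_prior_neighbour[OF assms(3) a(1) _ b(2) _ False] by blast
    then show thesis by (rule that)
  qed
qed

context unit_interval_representation
begin

text \<open>The path passes the point \<open>f (\<sigma> ! i)\<close>, which yields a neighbour
  \<open>\<sigma> ! k\<close> of \<open>\<sigma> ! i\<close> with \<open>k > j\<close>. The
  four-point property then gives an earlier neighbour \<open>\<sigma> ! l\<close> of
  \<open>\<sigma> ! j\<close> missing \<open>\<sigma> ! k\<close>; it lies so far right that it
  misses \<open>\<sigma> ! i\<close> too. Thus \<open>i\<close>, \<open>l\<close> replace
  \<open>i\<close>, \<open>j\<close>.\<close>

lemma mns_step:
  assumes \<sigma>: "mns_ordering G \<sigma>" and ij: "i < j" "j < length \<sigma>"
    and non_adj: "\<not> \<sigma> ! i \<rightarrow>\<^bsub>G\<^esub> \<sigma> ! j" and le: "f (\<sigma> ! i) \<le> f (\<sigma> ! j)"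
    and path: "(\<sigma> ! i, \<sigma> ! j) \<in> (edges_within G (insert (\<sigma> ! i) (insert (\<sigma> ! j) (set (drop (Suc j) \<sigma>)))))\<^sup>*"
  obtains l where "l < j" "\<sigma> ! l \<rightarrow>\<^bsub>G\<^esub> \<sigma> ! j" "l \<noteq> i" "\<not> \<sigma> ! i \<rightarrow>\<^bsub>G\<^esub> \<sigma> ! l"
proof -
  define W where "W = insert (\<sigma> ! i) (insert (\<sigma> ! j) (set (drop (Suc j) \<sigma>)))"
  have vo: "set \<sigma> = verts G" "distinct \<sigma>"
    using \<sigma> by (auto simp: mns_ordering_def vertex_ordering_def)
  have inV: "\<sigma> ! k \<in> verts G" if "k < length \<sigma>" for k
    using nth_mem[OF that] vo(1) by simp
  have "\<sigma> ! i \<noteq> \<sigma> ! j" using ij vo by (simp add: nth_eq_iff_index_eq)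
  then have far: "f (\<sigma> ! i) + len < f (\<sigma> ! j)"
    using non_adj le adj_iff[of "\<sigma> ! i" "\<sigma> ! j"] inV ij by auto
  then have "\<not> f (\<sigma> ! j) \<le> f (\<sigma> ! i)" using len_nonneg by auto
  with path[folded W_def] order_refl[of "f (\<sigma> ! i)"] obtain u v where
    edge: "(u, v) \<in> edges_within G W" "f u \<le> f (\<sigma> ! i)" "\<not> f v \<le> f (\<sigma> ! i)"
    by (rule rtrancl_exit_edge[where P = "\<lambda>w. f w \<le> f (\<sigma> ! i)"])
  then have uv: "u \<rightarrow>\<^bsub>G\<^esub> v" "u \<in> W" "v \<in> W" "f u \<le> f (\<sigma> ! i)" "f (\<sigma> ! i) < f v"
    by (simp_all add: edges_within_def)
  have V: "u \<in> verts G" "v \<in> verts G" using adj_in_verts[OF uv(1)] by simp_all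
  have "f v \<le> f u + len" using uv(1) adj_iff[OF V] by auto
  \<comment> \<open>\<open>v\<close> lies to the right of \<open>\<sigma> ! i\<close> by at most
    \<open>len\<close>, but \<open>\<sigma> ! j\<close> by more; only the later vertices of the path
    remain.\<close>
  then have "v \<noteq> \<sigma> ! j" "v \<noteq> \<sigma> ! i" using far uv by auto
  then have "v \<in> set (drop (Suc j) \<sigma>)" using uv by (auto simp: W_def)
  then obtain m where m: "m < length (drop (Suc j) \<sigma>)" "drop (Suc j) \<sigma> ! m = v"
    unfolding in_set_conv_nth by blast
  define k where "k = Suc j + m"
  have k: "j < k" "k < length \<sigma>" "v = \<sigma> ! k" using m by (simp_all add: k_def)
  have fv: "f (\<sigma> ! k) \<le> f (\<sigma> ! i) + len" "f (\<sigma> ! i) < f (\<sigma> ! k)"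
    using uv(4,5) \<open>f v \<le> f u + len\<close> k(3) by simp_all
  have inVs: "\<sigma> ! i \<in> verts G" "\<sigma> ! j \<in> verts G" "\<sigma> ! k \<in> verts G"
    using inV ij k(2) by simp_all
  have iv: "\<sigma> ! i \<rightarrow>\<^bsub>G\<^esub> \<sigma> ! k"
    using fv adj_iff[OF inVs(1,3)] by auto
  obtain l where l: "l < j" "\<sigma> ! l \<rightarrow>\<^bsub>G\<^esub> \<sigma> ! j" "\<not> \<sigma> ! l \<rightarrow>\<^bsub>G\<^esub> \<sigma> ! k"
    by (rule mns_ordering_prior_neighbour[OF \<sigma> ij(1) k(1,2) iv non_adj])
  have lV: "\<sigma> ! l \<in> verts G" using inV l(1) ij(2) by simp
  have "\<sigma> ! l \<noteq> \<sigma> ! k" using l(1) k(1,2) vo(2) by (simp add: nth_eq_iff_index_eq)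
  then have "\<bar>f (\<sigma> ! l) - f (\<sigma> ! k)\<bar> > len" using l(3) adj_iff[OF lV inVs(3)] by simp
  moreover have "\<bar>f (\<sigma> ! l) - f (\<sigma> ! j)\<bar> \<le> len" using l(2) adj_iff[OF lV inVs(2)] by simp
  \<comment> \<open>If \<open>\<sigma> ! l\<close> were more than \<open>len\<close> to the left of
    \<open>\<sigma> ! k\<close>, it would be left of \<open>\<sigma> ! i\<close> and out of reach of
    \<open>\<sigma> ! j\<close>. So it is on the right of \<open>\<sigma> ! k\<close>.\<close>
  ultimately have "f (\<sigma> ! i) + len < f (\<sigma> ! l)" using fv far by linarith
  then have "\<not> \<sigma> ! i \<rightarrow>\<^bsub>G\<^esub> \<sigma> ! l" using adj_iff[OF inVs(1) lV] by auto
  moreover have "l \<noteq> i" using l(3) iv by blast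
  ultimately show thesis using that l(1,2) by blast
qed

text \<open>The analogue, for unit interval graphs, of the lemma behind perfect elimination orderings of
  chordal graphs: the step above moves the later end point to an earlier position.\<close>

lemma mns_no_later_path:
  assumes \<sigma>: "mns_ordering G \<sigma>"
  shows "i < j \<Longrightarrow> j < length \<sigma> \<Longrightarrow> \<not> \<sigma> ! i \<rightarrow>\<^bsub>G\<^esub> \<sigma> ! j \<Longrightarrow>
    (\<sigma> ! i, \<sigma> ! j) \<notin> (edges_within G (insert (\<sigma> ! i) (insert (\<sigma> ! j) (set (drop (Suc j) \<sigma>)))))\<^sup>*"
proof (induction j arbitrary: i rule: less_induct)
  case (less j)
  define W where "W i j = insert (\<sigma> ! i) (insert (\<sigma> ! j) (set (drop (Suc j) \<sigma>)))" for i j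
  interpret R: unit_interval_representation G "\<lambda>v. - f v" len by (rule reflect)
  show ?case
  proof
    assume path: "(\<sigma> ! i, \<sigma> ! j) \<in> (edges_within G (insert (\<sigma> ! i) (insert (\<sigma> ! j) (set (drop (Suc j) \<sigma>)))))\<^sup>*"
    \<comment> \<open>\<open>mns_step\<close> wants \<open>\<sigma> ! i\<close> on the left; the
      other case is its mirror image.\<close>
    obtain l where l: "l < j" "\<sigma> ! l \<rightarrow>\<^bsub>G\<^esub> \<sigma> ! j" "l \<noteq> i" "\<not> \<sigma> ! i \<rightarrow>\<^bsub>G\<^esub> \<sigma> ! l"
    proof (cases "f (\<sigma> ! i) \<le> f (\<sigma> ! j)")
      case True
      show thesis by (rule mns_step[OF \<sigma> less.prems True path]) (rule that)
    next
      case False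
      then have "- f (\<sigma> ! i) \<le> - f (\<sigma> ! j)" by simp
      then show thesis by (rule R.mns_step[OF \<sigma> less.prems _ path]) (rule that)
    qed
    \<comment> \<open>\<open>l\<close> may come before or after \<open>i\<close>. The larger index
      \<open>b\<close> is below \<open>j\<close>, which makes the induction descend.\<close>
    define a b where ab: "a = min i l" "b = max i l"
    have lt: "a < b" "b < j" using l less.prems by (auto simp: ab)
    have "\<sigma> ! k \<in> set (drop (Suc b) \<sigma>)" if "b < k" "k < length \<sigma>" for k
    proof -
      have "drop (Suc b) \<sigma> ! (k - Suc b) \<in> set (drop (Suc b) \<sigma>)"
        using that by (intro nth_mem) simp
      then show ?thesis using that by simp
    qed
    moreover have "set (drop (Suc j) \<sigma>) \<subseteq> set (drop (Suc b) \<sigma>)"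
      using lt by (intro set_drop_subset_set_drop) simp
    moreover have "{\<sigma> ! a, \<sigma> ! b} = {\<sigma> ! i, \<sigma> ! l}" by (auto simp: ab min_def max_def)
    \<comment> \<open>\<open>\<sigma> ! j\<close> now counts as one of the vertices after
      \<open>b\<close>, so the old path followed by the edge to \<open>\<sigma> ! l\<close> is
      admissible for the new pair.\<close>
    ultimately have sub: "insert (\<sigma> ! l) (W i j) \<subseteq> W a b"
      using lt(2) less.prems(2) unfolding W_def by blast
    then have mono: "edges_within G (W i j) \<subseteq> edges_within G (W a b)"
      by (auto simp: edges_within_def)
    have "(\<sigma> ! i, \<sigma> ! j) \<in> (edges_within G (W a b))\<^sup>*"
      using path rtrancl_mono[OF mono] unfolding W_def by blast
    moreover have "(\<sigma> ! j, \<sigma> ! l) \<in> edges_within G (W a b)"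
      using adj_sym[OF l(2)] sub unfolding edges_within_def by (simp add: W_def)
    ultimately have "(\<sigma> ! i, \<sigma> ! l) \<in> (edges_within G (W a b))\<^sup>*" by (rule rtrancl_into_rtrancl)
    then have "(\<sigma> ! a, \<sigma> ! b) \<in> (edges_within G (W a b))\<^sup>*"
      using edges_within_rtrancl_sym[of "\<sigma> ! i" "\<sigma> ! l" "W a b"]
      by (cases "i \<le> l") (simp_all add: ab min_def max_def)
    moreover have "\<not> \<sigma> ! a \<rightarrow>\<^bsub>G\<^esub> \<sigma> ! b" using l(4) adj_sym[of "\<sigma> ! l" "\<sigma> ! i"] by (auto simp: ab min_def max_def)
    ultimately show False using less.IH[of b a] lt less.prems(2) by (simp add: W_def)
  qed
qed

text \<open>Non-adjacent neighbours of the last vertex would be joined by a path through it, and it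
  comes after both; \<open>mns_no_later_path\<close> forbids this.\<close>

lemma mns_last_simplicial:
  assumes \<sigma>: "mns_ordering G \<sigma>" and ne: "verts G \<noteq> {}"
  shows "simplicial G (last \<sigma>)"
proof -
  have vo: "set \<sigma> = verts G" "distinct \<sigma>" "\<sigma> \<noteq> []"
    using \<sigma> ne by (auto simp: mns_ordering_def vertex_ordering_def)
  define n where "n = length \<sigma> - 1"
  have n: "last \<sigma> = \<sigma> ! n" "n < length \<sigma>" "length \<sigma> = Suc n" using vo by (auto simp: last_conv_nth n_def)
  have less: "\<sigma> ! i \<rightarrow>\<^bsub>G\<^esub> \<sigma> ! j"
    if ij: "i < j" "j < length \<sigma>" "\<sigma> ! n \<rightarrow>\<^bsub>G\<^esub> \<sigma> ! i" "\<sigma> ! n \<rightarrow>\<^bsub>G\<^esub> \<sigma> ! j" for i j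
  proof (rule ccontr)
    assume non_adj: "\<not> \<sigma> ! i \<rightarrow>\<^bsub>G\<^esub> \<sigma> ! j"
    define W where "W = insert (\<sigma> ! i) (insert (\<sigma> ! j) (set (drop (Suc j) \<sigma>)))"
    have "j \<noteq> n" using ij(4) adj_not_same by blast
    have "\<sigma> ! n \<in> set (drop (Suc j) \<sigma>)"
    proof -
      have "drop (Suc j) \<sigma> ! (n - Suc j) \<in> set (drop (Suc j) \<sigma>)"
        using \<open>j \<noteq> n\<close> ij(2) n(3) by (intro nth_mem) simp
      then show ?thesis using \<open>j \<noteq> n\<close> ij(2) n(3) by simp
    qed
    then have "(\<sigma> ! i, \<sigma> ! n) \<in> edges_within G W" "(\<sigma> ! n, \<sigma> ! j) \<in> edges_within G W"
      using ij adj_sym[OF ij(3)] by (simp_all add: edges_within_def W_def)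
    then have "(\<sigma> ! i, \<sigma> ! j) \<in> (edges_within G W)\<^sup>*" by (meson r_into_rtrancl rtrancl_trans)
    then show False using mns_no_later_path[OF \<sigma> ij(1,2) non_adj] by (simp add: W_def)
  qed
  have "u \<rightarrow>\<^bsub>G\<^esub> v" if uv: "\<sigma> ! n \<rightarrow>\<^bsub>G\<^esub> u" "\<sigma> ! n \<rightarrow>\<^bsub>G\<^esub> v" "u \<noteq> v" for u v
  proof -
    have "u \<in> set \<sigma>" "v \<in> set \<sigma>" using adj_in_verts(2)[OF uv(1)] adj_in_verts(2)[OF uv(2)] vo(1) by simp_all
    then obtain i j where ij: "i < length \<sigma>" "j < length \<sigma>" "u = \<sigma> ! i" "v = \<sigma> ! j"
      by (auto simp: in_set_conv_nth)
    have "i \<noteq> j" using ij uv(3) by blast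
    then consider "i < j" | "j < i" by linarith
    then show ?thesis
    proof cases
      case 1
      then show ?thesis using less[of i j] ij uv by simp
    next
      case 2
      then have "v \<rightarrow>\<^bsub>G\<^esub> u" using less[of j i] ij uv by simp
      then show ?thesis by (rule adj_sym)
    qed
  qed
  moreover have "\<sigma> ! n \<in> verts G" using nth_mem[OF n(2)] vo(1) by simp
  ultimately show ?thesis
    unfolding simplicial_def clique_def neighbourhood_def n(1) by blast
qed

text \<open>When a vertex further left than \<open>N[t]\<close> is first numbered, its label is properly contained
  in that of \<open>t\<close>, since a search started on the right has to cross \<open>t\<close> along an edge first.\<close>

lemma mns_last_no_left_non_neighbour:
  assumes conn: "Digraph_Component.connected G" and \<sigma>: "mns_ordering G \<sigma>"
    and start: "f (last \<sigma>) \<le> f (\<sigma> ! 0)" and c: "c \<in> verts G"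
  shows "f (last \<sigma>) - len \<le> f c"
proof (rule ccontr)
  assume "\<not> f (last \<sigma>) - len \<le> f c"
  then have c_left: "f c < f (last \<sigma>) - len" by simp
  have vo: "set \<sigma> = verts G" "distinct \<sigma>" "\<sigma> \<noteq> []"
    using \<sigma> c by (auto simp: mns_ordering_def vertex_ordering_def)
  define n where "n = length \<sigma> - 1"
  have n: "last \<sigma> = \<sigma> ! n" "n < length \<sigma>" "length \<sigma> = Suc n" using vo by (auto simp: last_conv_nth n_def)
  have inV: "\<sigma> ! k \<in> verts G" if "k < length \<sigma>" for k
    using nth_mem[OF that] vo(1) by simp
  have "\<exists>i. i < length \<sigma> \<and> f (\<sigma> ! i) < f (\<sigma> ! n) - len"
  proof -
    have "c \<in> set \<sigma>" using c vo(1) by simp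
    then obtain i where "i < length \<sigma>" "\<sigma> ! i = c" unfolding in_set_conv_nth by blast
    then show ?thesis using c_left n(1) by auto
  qed
  \<comment> \<open>\<open>\<sigma> ! i\<close> is the first vertex numbered beyond the left end of
    N[t], where \<open>t\<close> is the last vertex \<open>\<sigma> ! n\<close>; below,
    \<open>\<sigma> ! j\<close> is the first one left of \<open>t\<close>.\<close>
  then obtain i where i: "i < length \<sigma>" "f (\<sigma> ! i) < f (\<sigma> ! n) - len"
    and i_min: "\<And>l. l < i \<Longrightarrow> \<not> (l < length \<sigma> \<and> f (\<sigma> ! l) < f (\<sigma> ! n) - len)"
    using exists_least_iff[of "\<lambda>i. i < length \<sigma> \<and> f (\<sigma> ! i) < f (\<sigma> ! n) - len"] by blast
  have i_left: "f (\<sigma> ! i) < f (\<sigma> ! n)" using i(2) len_nonneg by simp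
  with i(1) have "\<exists>j. j < length \<sigma> \<and> f (\<sigma> ! j) < f (\<sigma> ! n)" by blast
  then obtain j where j: "j < length \<sigma>" "f (\<sigma> ! j) < f (\<sigma> ! n)"
    and j_min: "\<And>l. l < j \<Longrightarrow> \<not> (l < length \<sigma> \<and> f (\<sigma> ! l) < f (\<sigma> ! n))"
    using exists_least_iff[of "\<lambda>j. j < length \<sigma> \<and> f (\<sigma> ! j) < f (\<sigma> ! n)"] by blast
  have "j \<le> i" using j_min i(1) i_left not_le_imp_less by blast
  have "0 < j" using j(2) start n(1) by (cases j) simp_all
  then obtain k where k: "k < j" "\<sigma> ! k \<rightarrow>\<^bsub>G\<^esub> \<sigma> ! j"
    using mns_ordering_earlier_neighbour[OF sym_digraph_axioms conn \<sigma> _ j(1)] by blast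
  have "i \<noteq> n" using i(2) len_nonneg by auto
  then have "i < n" using i(1) n(3) by simp
  have V: "\<sigma> ! i \<in> verts G" "\<sigma> ! j \<in> verts G" "\<sigma> ! k \<in> verts G" "\<sigma> ! n \<in> verts G"
    using inV i(1) j(1) k(1) n(2) by simp_all
  \<comment> \<open>By minimality of \<open>j\<close> the edge from \<open>\<sigma> ! k\<close> to
    \<open>\<sigma> ! j\<close> crosses \<open>t\<close>. So \<open>\<sigma> ! k\<close> is within
    \<open>len\<close> of \<open>t\<close>, and it cannot reach \<open>\<sigma> ! i\<close>.\<close>
  have fk: "f (\<sigma> ! n) \<le> f (\<sigma> ! k)" using j_min[OF k(1)] k(1) j(1) by simp
  have fkj: "f (\<sigma> ! k) \<le> f (\<sigma> ! j) + len" using k(2) adj_iff[OF V(3,2)] by auto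
  have "j \<noteq> i" using fk fkj i(2) by auto
  then have "k < i" using \<open>j \<le> i\<close> k(1) by simp
  then have "\<sigma> ! k \<noteq> \<sigma> ! n" using \<open>i < n\<close> n(2) vo(2) by (simp add: nth_eq_iff_index_eq)
  then have kn: "\<sigma> ! k \<rightarrow>\<^bsub>G\<^esub> \<sigma> ! n" using fk fkj j(2) adj_iff[OF V(3,4)] by auto
  have ki: "\<not> \<sigma> ! k \<rightarrow>\<^bsub>G\<^esub> \<sigma> ! i" using i(2) fk adj_iff[OF V(3,1)] by auto
  obtain l where l: "l < i" "\<sigma> ! l \<rightarrow>\<^bsub>G\<^esub> \<sigma> ! i" "\<not> \<sigma> ! l \<rightarrow>\<^bsub>G\<^esub> \<sigma> ! n"
    by (rule mns_ordering_prior_neighbour[OF \<sigma> \<open>k < i\<close> \<open>i < n\<close> n(2) kn ki])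
  have lV: "\<sigma> ! l \<in> verts G" using inV l(1) i(1) by simp
  \<comment> \<open>By minimality of \<open>i\<close>, \<open>\<sigma> ! l\<close> is not beyond the
    left end of N[t], and as a neighbour of \<open>\<sigma> ! i\<close> it is left of
    \<open>t\<close>. So it would be adjacent to \<open>t\<close>.\<close>
  have "f (\<sigma> ! n) - len \<le> f (\<sigma> ! l)" using i_min[OF l(1)] l(1) i(1) by simp
  moreover have "f (\<sigma> ! l) \<le> f (\<sigma> ! i) + len" using l(2) adj_iff[OF lV V(1)] by auto
  moreover have "\<sigma> ! l \<noteq> \<sigma> ! n" using l(1) n(2) \<open>i < n\<close> vo(2) by (simp add: nth_eq_iff_index_eq)
  ultimately have "\<sigma> ! l \<rightarrow>\<^bsub>G\<^esub> \<sigma> ! n" using i(2) adj_iff[OF lV V(4)] by auto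
  then show False using l(3) by simp
qed

text \<open>The side of \<open>t\<close> opposite to the start vertex has no non-neighbours of
  \<open>t\<close>; which side that is decides whether the line has to be reflected.\<close>

lemma mns_last_imp_unit_interval_order:
  assumes conn: "Digraph_Component.connected G" and \<sigma>: "mns_ordering G \<sigma>"
  shows "\<exists>\<sigma>'. unit_interval_order G \<sigma>' \<and> last \<sigma>' = last \<sigma>"
proof (rule unit_interval_order_ending_at_if_one_sided)
  show "simplicial G (last \<sigma>)"
    using mns_last_simplicial[OF \<sigma>] conn by (simp add: connected_iff_rtrancl)
  interpret R: unit_interval_representation G "\<lambda>v. - f v" len by (rule reflect)
  fix c d assume "c \<in> verts G" "d \<in> verts G" "f c < f (last \<sigma>) - len"
  then show "f d \<le> f (last \<sigma>) + len"
    using mns_last_no_left_non_neighbour[OF conn \<sigma>] R.mns_last_no_left_non_neighbour[OF conn \<sigma>]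
    by (cases "f (last \<sigma>) \<le> f (\<sigma> ! 0)") force+
qed

end

theorem theorem17:
  fixes G :: "('a, 'b) pre_digraph" and t :: 'a
  assumes "unit_interval_graph G"
    and "Digraph_Component.connected G"
    and "t \<in> verts G"
  shows "((simplicial G t \<and> connected_or_null (delete_verts G (closed_neighbourhood G t)))
            \<longleftrightarrow> (\<exists>\<sigma>. unit_interval_order G \<sigma> \<and> last \<sigma> = t))
       \<and> ((\<exists>\<sigma>. unit_interval_order G \<sigma> \<and> last \<sigma> = t)
            \<longleftrightarrow> (\<exists>\<sigma>. mns_ordering G \<sigma> \<and> last \<sigma> = t))
       \<and> ((\<exists>\<sigma>. mns_ordering G \<sigma> \<and> last \<sigma> = t)
            \<longleftrightarrow> (\<exists>\<sigma>. mcs_ordering G \<sigma> \<and> last \<sigma> = t))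
       \<and> ((\<exists>\<sigma>. mns_ordering G \<sigma> \<and> last \<sigma> = t)
            \<longleftrightarrow> (\<exists>\<sigma>. ldfs_ordering G \<sigma> \<and> last \<sigma> = t))"
proof -
  obtain f len where "unit_interval_representation G f len"
    using unit_interval_graphE[OF assms(1)] .
  then interpret unit_interval_representation G f len .
  have G: "Digraph.graph G" "symmetric G" "verts G \<noteq> {}"
    using graph_axioms sym_arcs assms(3) by auto
  have "simplicial G t \<and> connected_or_null (delete_verts G (closed_neighbourhood G t))
      \<longleftrightarrow> (\<exists>\<sigma>. unit_interval_order G \<sigma> \<and> last \<sigma> = t)"
    using simplicial_connected_imp_unit_interval_order unit_interval_order_last_simplicial[OF G(1) _ G(3)]
      unit_interval_order_last_non_neighbours_connected[OF G(1) assms(2)] by blast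
  moreover have "\<exists>\<sigma>. unit_interval_order G \<sigma> \<and> last \<sigma> = t" if "mns_ordering G \<sigma>" "last \<sigma> = t" for \<sigma>
    using mns_last_imp_unit_interval_order[OF assms(2)] that by blast
  \<comment> \<open>The cycle closes: a unit interval order is itself an MCS and an LDFS ordering,
    these are MNS orderings, and an MNS ordering yields a unit interval order with the same last
    vertex.\<close>
  ultimately show ?thesis
    using unit_interval_order_is_mcs[OF _ G(2)] unit_interval_order_is_ldfs[OF _ G(3)]
      mcs_ordering_is_mns[OF _ G(2)] ldfs_ordering_is_mns by metis
qed

end
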